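(* Let $\mathcal D$ be a distribution on $\mathbb{R}^n$, $k\in\mathbb{N}$, $\varepsilon>0$, and $f:\mathbb{R}^n\to\mathbb{R}$. If $\inf_{g\in\mathcal J_k}\mathbb{E}_{\mathbf x\sim\mathcal D}|f(\mathbf x)-g(\mathbf x)|\ge\varepsilon$, then for every $S\subseteq[n]$ with $|S|\le k$, $\mathsf{Infl}_f([n]\setminus S)\ge\varepsilon$.
   Context: $\mathcal J_k$ is the set of $k$-juntas on $n$ variables: functions $g:\mathbb{R}^n\to\mathbb{R}$ with at most $k$ influential coordinates, where coordinate $i$ is influential if for some $\mathbf x$ changing only $x_i$ changes $g(\mathbf x)$. For $T\subseteq[n]$ and $\mathbf x,\mathbf y\in\mathbb{R}^n$, $\mathbf x_T\mathbf y_{\overline T}$ denotes the vector whose coordinates in $T$ are taken from $\mathbf x$ and whose coordinates in $\overline T=[n]\setminus T$ are taken from $\mathbf y$. The influence of $f$ on $T$ with respect to $\mathcal D$ is $\mathsf{Infl}_f(T)=\mathbb{E}_{\mathbf x,\mathbf y\sim\mathcal D}\big[|f(\mathbf y)-f(\mathbf x_T\mathbf y_{\overline T})|\big]$, with $\mathbf x,\mathbf y$ independent. *)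

theory Defs
  imports "HOL-Probability.Probability"
begin

definition influential :: "(real ^ 'n \<Rightarrow> real) \<Rightarrow> 'n \<Rightarrow> bool" where
  "influential g i \<longleftrightarrow> (\<exists>x y. (\<forall>j. j \<noteq> i \<longrightarrow> x $ j = y $ j) \<and> g x \<noteq> g y)"

definition juntas :: "nat \<Rightarrow> (real ^ 'n \<Rightarrow> real) set" where
  "juntas k = {g. card {i. influential g i} \<le> k}"

definition splice :: "'n set \<Rightarrow> real ^ 'n \<Rightarrow> real ^ 'n \<Rightarrow> real ^ 'n" where
  "splice T x y = (\<chi> i. if i \<in> T then x $ i else y $ i)"

text \<open>
  Expectations of absolute values are extended nonnegative integrals, so that a
  non-integrable difference has expectation \<open>\<infinity>\<close> and not the default value \<open>0\<close> of the
  Bochner integral. The product measure makes the two samples independent.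
\<close>

definition Infl :: "(real ^ 'n) measure \<Rightarrow> (real ^ 'n \<Rightarrow> real) \<Rightarrow> 'n set \<Rightarrow> ennreal" where
  "Infl D f T = (\<integral>\<^sup>+ (x, y). ennreal \<bar>f y - f (splice T x y)\<bar> \<partial>(D \<Otimes>\<^sub>M D))"

end

theory Submission
  imports Defs
begin

text \<open>
  For every fixed \<open>x\<close> the section \<open>y \<mapsto> f (x\<^sub>T y\<^sub>S)\<close>, with \<open>T\<close> the complement of \<open>S\<close>, depends on
  the coordinates in \<open>S\<close> only, so it is a \<open>k\<close>-junta and has distance at least \<open>\<epsilon>\<close> from \<open>f\<close>.
  By Tonelli, the influence is the average over \<open>x\<close> of these distances.
\<close>

lemma continuous_on_splice:
  "continuous_on UNIV (\<lambda>p. splice T (fst p) (snd p))"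
  unfolding splice_def
proof (rule continuous_on_vec_lambda)
  fix i
  show "continuous_on UNIV (\<lambda>p. if i \<in> T then fst p $ i else snd p $ i :: real)"
    by (cases "i \<in> T") (auto intro!: continuous_intros)
qed

text \<open>Continuity suffices because the spaces are second countable, so
  \<open>borel \<Otimes>\<^sub>M borel\<close> is the Borel algebra of the product. Joint
  measurability is what Tonelli needs.\<close>

lemma measurable_splice [measurable]:
  "(\<lambda>(x, y). splice T x y) \<in> borel \<Otimes>\<^sub>M borel \<rightarrow>\<^sub>M borel"
  using borel_measurable_continuous_onI[OF continuous_on_splice]
  by (simp add: borel_prod case_prod_beta')

text \<open>Splicing overwrites the coordinates of \<open>y\<close> in \<open>T\<close>, so changing
  one of them has no effect.\<close>

lemma influential_splice_subset:
  "{i. influential (\<lambda>y. f (splice T x y)) i} \<subseteq> - T"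
proof
  fix i
  assume "i \<in> {i. influential (\<lambda>y. f (splice T x y)) i}"
  then obtain y z where eq: "\<forall>j. j \<noteq> i \<longrightarrow> y $ j = z $ j"
    and neq: "f (splice T x y) \<noteq> f (splice T x z)"
    by (auto simp: influential_def)
  have "splice T x y = splice T x z" if "i \<in> T"
    using eq that by (auto simp: splice_def vec_eq_iff)
  with neq show "i \<in> - T"
    by auto
qed

lemma splice_section_in_juntas:
  assumes "card (- T) \<le> k"
  shows "(\<lambda>y. f (splice T x y)) \<in> juntas k"
  using card_mono[OF _ influential_splice_subset[of f T x]] assms
  by (simp add: juntas_def)

theorem theorem7p3:
  fixes D :: "(real ^ 'n) measure" and f :: "real ^ 'n \<Rightarrow> real"
    and k :: nat and \<epsilon> :: real
  assumes "prob_space D" and "sets D = sets borel"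
    and "\<epsilon> > 0"
    and "f \<in> borel_measurable borel"
    and "(INF g \<in> juntas k \<inter> borel_measurable borel.
            \<integral>\<^sup>+ x. ennreal \<bar>f x - g x\<bar> \<partial>D) \<ge> ennreal \<epsilon>"
  shows "\<forall>S :: 'n set. card S \<le> k \<longrightarrow> Infl D f (UNIV - S) \<ge> ennreal \<epsilon>"
proof (intro allI impI)
  fix S :: "'n set"
  assume card: "card S \<le> k"
  interpret prob_space D by fact
  note [measurable_cong] = assms(2)
  note [measurable] = assms(4)
  let ?T = "UNIV - S"
  have far: "ennreal \<epsilon> \<le> (\<integral>\<^sup>+ y. ennreal \<bar>f y - f (splice ?T x y)\<bar> \<partial>D)" for x
  proof -
    \<comment> \<open>The infimum ranges over Borel juntas, so a competitor must be measurable as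
      well as a junta.\<close>
    have "(\<lambda>y. f (splice ?T x y)) \<in> borel_measurable borel"
      by measurable
    moreover have "(\<lambda>y. f (splice ?T x y)) \<in> juntas k"
      using card by (intro splice_section_in_juntas) (simp add: Compl_eq_Diff_UNIV double_diff)
    ultimately show ?thesis
      by (intro order_trans[OF assms(5)] INF_lower2[OF _ order_refl]) simp
  qed
  \<comment> \<open>\<open>D\<close> has total mass 1, so the pointwise bound \<open>far\<close>
    survives averaging over \<open>x\<close>.\<close>
  have "ennreal \<epsilon> = (\<integral>\<^sup>+ x. ennreal \<epsilon> \<partial>D)"
    by (simp add: emeasure_space_1)
  also have "\<dots> \<le> (\<integral>\<^sup>+ x. \<integral>\<^sup>+ y. ennreal \<bar>f y - f (splice ?T x y)\<bar> \<partial>D \<partial>D)"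
    by (intro nn_integral_mono far)
  also have "\<dots> = Infl D f ?T"
    unfolding Infl_def by (subst nn_integral_fst[symmetric]) simp_all
  finally show "ennreal \<epsilon> \<le> Infl D f ?T" .
qed

end
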